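(* There exists a determinantal formula of pure Bézout type (i.e. there exists $m\in\mathbb{Z}^r$ which is determinantal and whose Weyman complex is of pure Bézout type) if and only if for all $k\in\{1,\dots,r\}$ either $l_k=1$ or $d_k=1$, i.e. all defects $\delta_k$ vanish.
   Context: Let $r\ge 1$ and let $l=(l_1,\dots,l_r)$, $d=(d_1,\dots,d_r)$ be vectors of positive integers; put $n=\sum_{k=1}^r l_k$. Let $X=\mathbb{P}^{l_1}\times\cdots\times\mathbb{P}^{l_r}$ over an algebraically closed field of characteristic zero. For $a\in\mathbb{Z}^r$, $H^q(X,a)$ denotes the $q$-th cohomology of the sheaf $\mathcal{O}_X(a_1,\dots,a_r)$. By the Künneth and Bott formulae, $H^q(X,a)=\bigoplus\bigotimes_{k}H^{j_k}(\mathbb{P}^{l_k},a_k)$ (sum over $j_k\in\{0,l_k\}$ with $\sum_k j_k=q$), where $H^0(\mathbb{P}^{l_k},a_k)\ne0\iff a_k\ge0$ and $H^{l_k}(\mathbb{P}^{l_k},a_k)\neq0\iff a_k<-l_k$. For a degree vector $m\in\mathbb{Z}^r$ and $\nu\in\mathbb{Z}$, the $\nu$-th term of the Weyman complex is $K_\nu(m)=\bigoplus_{p=0}^{n+1}H^{p-\nu}(X,m-pd)^{\binom{n+1}{p}}$. The vector $m$ is called determinantal if the complex has just the two terms $K_1(m)\to K_0(m)$, i.e. $K_\nu(m)=0$ for all $\nu\notin\{0,1\}$; by a result of Weyman and Zelevinsky this is equivalent to $K_{-1}(m)=K_2(m)=0$. The Weyman complex of $m$ is of pure Bézout type if $K_{-1}(m)=0$,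 $K_1(m)=H^{n}(X,m-(n+1)d)$ and $K_0(m)=H^0(X,m)$ (all other summands of $K_1(m)$, $K_0(m)$ vanish), these two groups being nonzero. The defect vector $\delta\in\mathbb{Z}^r$ is $\delta_k=l_k-\lceil l_k/d_k\rceil$. *)

theory Defs
  imports Complex_Main "HOL-Library.Poly_Mapping" "HOL-Library.FuncSet"
    "HOL-Computational_Algebra.Polynomial"
begin

text \<open>
  The finite type \<open>'r\<close> indexes the factors of \<open>X = P^(l 1) \<times> \<dots> \<times> P^(l r)\<close>, over the field \<open>'k\<close>.
  The homogeneous coordinates of the \<open>k\<close>-th factor are \<open>x k 0, \<dots>, x k (l k)\<close>.

  The sheaf cohomology of \<open>O(a)\<close> is defined as Cech cohomology with respect to the standard affine
  cover of \<open>X\<close> by the open sets \<open>U \<sigma> = {x. \<forall>k. x k (\<sigma> k) \<noteq> 0}\<close>; all intersections of these sets are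
  affine, so this computes \<open>H^q(X, O(a))\<close>. The sections of \<open>O(a)\<close> over the intersection of the
  \<open>U \<sigma>\<close>, \<open>\<sigma> \<in> S\<close>, are the Laurent polynomials of multidegree \<open>a\<close> in the \<open>x k i\<close> in which only the
  variables \<open>x k (\<sigma> k)\<close>, \<open>\<sigma> \<in> S\<close>, may have negative exponents.
\<close>

type_synonym 'r expo = "'r \<Rightarrow> nat \<Rightarrow> int"

type_synonym ('r, 'k) laurent = "'r expo \<Rightarrow>\<^sub>0 'k"

type_synonym ('r, 'k) cochain = "('r \<Rightarrow> nat) list \<Rightarrow> ('r, 'k) laurent"

definition cover :: "('r \<Rightarrow> nat) \<Rightarrow> ('r \<Rightarrow> nat) set" where
  "cover l = {\<sigma>. \<forall>k. \<sigma> k \<le> l k}"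

definition sections ::
  "('r \<Rightarrow> nat) \<Rightarrow> ('r \<Rightarrow> int) \<Rightarrow> ('r \<Rightarrow> nat) set \<Rightarrow> ('r, 'k::zero) laurent set" where
  "sections l a S = {f. \<forall>e \<in> Poly_Mapping.keys f.
      (\<forall>k i. l k < i \<longrightarrow> e k i = 0) \<and>
      (\<forall>k. (\<Sum>i\<le>l k. e k i) = a k) \<and>
      (\<forall>k i. e k i < 0 \<longrightarrow> (\<exists>\<sigma>\<in>S. \<sigma> k = i))}"

text \<open>
  Cochains are not required to be alternating: a \<open>q\<close>-cochain assigns a section to every
  \<open>(q+1)\<close>-tuple of members of the cover. The degree is an integer; there are no nonzero cochains in
  negative degrees.
\<close>

definition simplices :: "('r \<Rightarrow> nat) \<Rightarrow> int \<Rightarrow> ('r \<Rightarrow> nat) list set" where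
  "simplices l q = {s. s \<noteq> [] \<and> set s \<subseteq> cover l \<and> int (length s) = q + 1}"

definition cochains ::
  "('r \<Rightarrow> nat) \<Rightarrow> int \<Rightarrow> ('r \<Rightarrow> int) \<Rightarrow> ('r, 'k::zero) cochain set" where
  "cochains l q a = {c. (\<forall>s \<in> simplices l q. c s \<in> sections l a (set s)) \<and>
      (\<forall>s. s \<notin> simplices l q \<longrightarrow> c s = 0)}"

text \<open>
  The differential from degree \<open>q\<close> to degree \<open>q + 1\<close>. Restriction of sections is the inclusion of
  Laurent polynomials.
\<close>

definition coboundary ::
  "('r \<Rightarrow> nat) \<Rightarrow> int \<Rightarrow> ('r, 'k::ab_group_add) cochain \<Rightarrow> ('r, 'k) cochain" where
  "coboundary l q c = (\<lambda>s. if s \<in> simplices l (q + 1)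
      then \<Sum>j<length s. (let t = take j s @ drop (Suc j) s in if even j then c t else - c t)
      else 0)"

definition cocycles ::
  "('r \<Rightarrow> nat) \<Rightarrow> int \<Rightarrow> ('r \<Rightarrow> int) \<Rightarrow> ('r, 'k::ab_group_add) cochain set" where
  "cocycles l q a = {c \<in> cochains l q a. \<forall>s. coboundary l q c s = 0}"

definition coboundaries ::
  "('r \<Rightarrow> nat) \<Rightarrow> int \<Rightarrow> ('r \<Rightarrow> int) \<Rightarrow> ('r, 'k::ab_group_add) cochain set" where
  "coboundaries l q a = coboundary l (q - 1) ` cochains l (q - 1) a"

definition cohomology ::
  "('r \<Rightarrow> nat) \<Rightarrow> int \<Rightarrow> ('r \<Rightarrow> int) \<Rightarrow> ('r, 'k::ab_group_add) cochain set set" where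
  "cohomology l q a = cocycles l q a //
     {(c, c'). c \<in> cocycles l q a \<and> c' \<in> cocycles l q a \<and> c - c' \<in> coboundaries l q a}"

text \<open>
  Cohomology groups and the terms built from them enter only through their vanishing; they are
  represented by their underlying sets, and such a vector space is zero iff it has exactly one
  element. Finite direct sums are dependent function spaces.
\<close>

definition vanishes :: "'v set \<Rightarrow> bool" where
  "vanishes V \<longleftrightarrow> is_singleton V"

definition total_dim :: "('r::finite \<Rightarrow> nat) \<Rightarrow> nat" where
  "total_dim l = (\<Sum>k\<in>UNIV. l k)"

definition twist :: "('r \<Rightarrow> nat) \<Rightarrow> ('r \<Rightarrow> int) \<Rightarrow> nat \<Rightarrow> 'r \<Rightarrow> int" where
  "twist d m p = (\<lambda>k. m k - int p * int (d k))"

definition weyman_summand ::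
  "('r::finite \<Rightarrow> nat) \<Rightarrow> ('r \<Rightarrow> nat) \<Rightarrow> ('r \<Rightarrow> int) \<Rightarrow> int \<Rightarrow> nat \<Rightarrow>
   (nat \<Rightarrow> ('r, 'k::ab_group_add) cochain set) set" where
  "weyman_summand l d m \<nu> p =
     (\<Pi>\<^sub>E j \<in> {..<(total_dim l + 1) choose p}. cohomology l (int p - \<nu>) (twist d m p))"

definition weyman_term ::
  "('r::finite \<Rightarrow> nat) \<Rightarrow> ('r \<Rightarrow> nat) \<Rightarrow> ('r \<Rightarrow> int) \<Rightarrow> int \<Rightarrow>
   (nat \<Rightarrow> nat \<Rightarrow> ('r, 'k::ab_group_add) cochain set) set" where
  "weyman_term l d m \<nu> = (\<Pi>\<^sub>E p \<in> {..total_dim l + 1}. weyman_summand l d m \<nu> p)"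

definition determinantal ::
  "'k::ab_group_add itself \<Rightarrow> ('r::finite \<Rightarrow> nat) \<Rightarrow> ('r \<Rightarrow> nat) \<Rightarrow> ('r \<Rightarrow> int) \<Rightarrow> bool" where
  "determinantal K l d m \<longleftrightarrow>
     (\<forall>\<nu>. \<nu> \<notin> {0, 1} \<longrightarrow>
        vanishes (weyman_term l d m \<nu> :: (nat \<Rightarrow> nat \<Rightarrow> ('r, 'k) cochain set) set))"

definition pure_Bezout ::
  "'k::ab_group_add itself \<Rightarrow> ('r::finite \<Rightarrow> nat) \<Rightarrow> ('r \<Rightarrow> nat) \<Rightarrow> ('r \<Rightarrow> int) \<Rightarrow> bool" where
  "pure_Bezout K l d m \<longleftrightarrow>
     (let n = total_dim l;
          H = (cohomology l :: int \<Rightarrow> ('r \<Rightarrow> int) \<Rightarrow> ('r, 'k) cochain set set);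
          S = (weyman_summand l d m :: int \<Rightarrow> nat \<Rightarrow> (nat \<Rightarrow> ('r, 'k) cochain set) set)
      in vanishes (weyman_term l d m (- 1) :: (nat \<Rightarrow> nat \<Rightarrow> ('r, 'k) cochain set) set) \<and>
         (\<forall>p \<le> n + 1. p \<noteq> n + 1 \<longrightarrow> vanishes (S 1 p)) \<and>
         (\<forall>p \<le> n + 1. p \<noteq> 0 \<longrightarrow> vanishes (S 0 p)) \<and>
         \<not> vanishes (H (int n) (twist d m (n + 1))) \<and>
         \<not> vanishes (H 0 m))"

definition defect :: "('r \<Rightarrow> nat) \<Rightarrow> ('r \<Rightarrow> nat) \<Rightarrow> 'r \<Rightarrow> int" where
  "defect l d k = int (l k) - \<lceil>real (l k) / real (d k)\<rceil>"

end

theory Submission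
  imports Defs
begin

text \<open>
  The Cech complex splits into one complex for each Laurent monomial \<open>e\<close>. Its cochains are the
  functions on tuples of charts such that every pair \<open>(k, i)\<close> with \<open>e k i < 0\<close> is hit by a chart
  \<open>\<sigma>\<close> of the tuple, \<open>\<sigma> k = i\<close>. Requiring tuples to hit one more set \<open>A\<close> gives the kernel of the
  restriction to tuples avoiding \<open>A\<close>; the resulting long exact sequences, together with the cone
  construction on a chart lying in no set to be hit, give the Bott and Kuenneth vanishing pattern by
  induction.

  In a determinantal complex of pure Bezout type no \<open>m - p d\<close> with \<open>1 \<le> p \<le> n\<close> has cohomology,
  so each such \<open>p\<close> satisfies \<open>- l k \<le> m k - p d k \<le> - 1\<close> for some \<open>k\<close>. At most \<open>l k\<close> values of \<open>p\<close>
  do so for a given \<open>k\<close>, and fewer if \<open>l k, d k \<ge> 2\<close>. Since \<open>n\<close> is the sum of the \<open>l k\<close>, no loss is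
  possible. Conversely, if \<open>l k = 1\<close> or \<open>d k = 1\<close> for all \<open>k\<close>, the ranges can be arranged to tile
  \<open>{1..n}\<close>.
\<close>

section \<open>Cochains on tuples hitting given sets\<close>

text \<open>The alternating sum over omitted entries, unrolled at the head so that its identities
  follow by list induction. Since \<open>cobd f [x] = f []\<close>, the empty tuple takes part: this
  is the augmented differential.\<close>

primrec cobd :: "('v list \<Rightarrow> 'k::ab_group_add) \<Rightarrow> 'v list \<Rightarrow> 'k" where
  "cobd f [] = 0"
| "cobd f (x # s) = f s - cobd (\<lambda>t. f (x # t)) s"

lemma cobd_conv_sum:
  "cobd f s = (\<Sum>j<length s. let t = take j s @ drop (Suc j) s in if even j then f t else - f t)"
proof (induction s arbitrary: f)
  case (Cons x s)
  let ?F = "\<lambda>f s j. let t = take j s @ drop (Suc j) s in if even j then f t else - f t"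
  have "?F f (x # s) (Suc j) = - ?F (\<lambda>t. f (x # t)) s j" for j
    by (simp add: Let_def)
  then have "(\<Sum>j<length (x # s). ?F f (x # s) j) = f s - (\<Sum>j<length s. ?F (\<lambda>t. f (x # t)) s j)"
    unfolding length_Cons sum.lessThan_Suc_shift by (simp add: sum_negf)
  then show ?case by (simp only: Cons.IH cobd.simps)
qed simp

lemma cobd_cong:
  assumes "\<And>t. set t \<subseteq> set s \<Longrightarrow> Suc (length t) = length s \<Longrightarrow> f t = g t"
  shows "cobd f s = cobd g s"
  using assms
proof (induction s arbitrary: f g)
  case (Cons x s)
  have "cobd (\<lambda>t. f (x # t)) s = cobd (\<lambda>t. g (x # t)) s"
    by (rule Cons.IH) (auto intro!: Cons.prems)
  moreover have "f s = g s"
    by (rule Cons.prems) auto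
  ultimately show ?case by simp
qed simp

lemma cobd_zero: "cobd (\<lambda>t. 0) s = 0"
  by (induction s) auto

lemma cobd_eq_0:
  assumes "\<And>t. set t \<subseteq> set s \<Longrightarrow> Suc (length t) = length s \<Longrightarrow> f t = 0"
  shows "cobd f s = 0"
  using cobd_cong[of s f "\<lambda>t. 0"] assms by (simp add: cobd_zero)

lemma cobd_diff: "cobd (\<lambda>t. f t - g t) s = cobd f s - cobd g s"
  by (induction s arbitrary: f g) auto

text \<open>At \<open>x # s\<close> the two copies of \<open>cobd f s\<close> cancel, which leaves
  the same claim for \<open>\<lambda>t. f (x # t)\<close> at \<open>s\<close>.\<close>

lemma cobd_cobd: "cobd (cobd f) s = 0"
  by (induction s arbitrary: f) (auto simp: cobd_diff)

lemma lookup_cobd: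
  "Poly_Mapping.lookup (cobd c s) e = cobd (\<lambda>t. Poly_Mapping.lookup (c t) e) s"
  by (induction s arbitrary: c) (auto simp: lookup_minus)

definition hits :: "'v set set \<Rightarrow> 'v list \<Rightarrow> bool" where
  "hits F s \<longleftrightarrow> (\<forall>A\<in>F. set s \<inter> A \<noteq> {})"

lemma hits_mono: "hits F t \<Longrightarrow> set t \<subseteq> set s \<Longrightarrow> hits F s"
  unfolding hits_def by blast

lemma hits_UNIV: "hits {UNIV} s \<longleftrightarrow> s \<noteq> []"
  unfolding hits_def by auto

lemma hits_empty: "hits {} s"
  unfolding hits_def by simp

lemma hits_insert: "hits (insert A F) s \<longleftrightarrow> set s \<inter> A \<noteq> {} \<and> hits F s"
  unfolding hits_def by blast

text \<open>Only the values on tuples with entries in \<open>V\<close> matter.\<close>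

definition hcochains :: "'v set \<Rightarrow> 'v set set \<Rightarrow> int \<Rightarrow> ('v list \<Rightarrow> 'k::zero) set" where
  "hcochains V F t =
     {f. \<forall>s. set s \<subseteq> V \<longrightarrow> f s \<noteq> 0 \<longrightarrow> int (length s) = t \<and> hits F s}"

lemma hcochainsD:
  "f \<in> hcochains V F t \<Longrightarrow> set s \<subseteq> V \<Longrightarrow> f s \<noteq> 0 \<Longrightarrow> int (length s) = t \<and> hits F s"
  unfolding hcochains_def by blast

text \<open>The index \<open>t\<close> is the tuple length, so Cech degree \<open>q\<close>
  corresponds to \<open>t = q + 1\<close>. \<open>K\<close> only fixes the coefficient type.\<close>

definition exact_at :: "'k::ab_group_add itself \<Rightarrow> 'v set \<Rightarrow> 'v set set \<Rightarrow> int \<Rightarrow> bool" where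
  "exact_at K V F t \<longleftrightarrow> (\<forall>f :: 'v list \<Rightarrow> 'k. f \<in> hcochains V F t \<longrightarrow>
     (\<forall>s. set s \<subseteq> V \<longrightarrow> cobd f s = 0) \<longrightarrow>
     (\<exists>g \<in> hcochains V F (t - 1). \<forall>s. set s \<subseteq> V \<longrightarrow> f s = cobd g s))"

text \<open>A nonzero coboundary value needs a face with nonzero value; that face hits
  \<open>F\<close>, and further entries cannot undo this.\<close>

lemma hcochains_cobd:
  assumes "f \<in> hcochains V F t"
  shows "cobd f \<in> hcochains V F (t + 1)"
  unfolding hcochains_def
proof (intro CollectI allI impI)
  fix s assume s: "set s \<subseteq> V" "cobd f s \<noteq> 0"
  then obtain u where u: "set u \<subseteq> set s" "Suc (length u) = length s" "f u \<noteq> 0"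
    using cobd_eq_0[of s f] by blast
  then have "int (length u) = t \<and> hits F u"
    using assms s(1) unfolding hcochains_def by blast
  then show "int (length s) = t + 1 \<and> hits F s"
    using u hits_mono[of F u s] by auto
qed

lemma hcochains_diff:
  fixes f g :: "'v list \<Rightarrow> 'k::ab_group_add"
  assumes "f \<in> hcochains V F t" "g \<in> hcochains V F t"
  shows "(\<lambda>s. f s - g s) \<in> hcochains V F t"
  using assms unfolding hcochains_def by fastforce

lemma hcochains_subset:
  assumes "W \<subseteq> V" "F \<subseteq> G"
  shows "hcochains V G t \<subseteq> hcochains W F t"
proof
  fix f :: "'a list \<Rightarrow> 'b"
  assume "f \<in> hcochains V G t"
  then have "int (length s) = t \<and> hits G s" if "set s \<subseteq> W" "f s \<noteq> 0" for s
    using hcochainsD that assms(1) by (metis subset_trans)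
  moreover have "hits G s \<Longrightarrow> hits F s" for s
    using assms(2) unfolding hits_def by blast
  ultimately show "f \<in> hcochains W F t"
    unfolding hcochains_def by simp
qed

lemma hcochains_extend:
  assumes "f \<in> hcochains W F t"
  shows "(\<lambda>s. if set s \<subseteq> W then f s else 0) \<in> hcochains V F t"
  using assms unfolding hcochains_def by auto

text \<open>With \<open>hcochains_insertD\<close>, this identifies the cochains for
  \<open>insert A F\<close> as the kernel of restriction to \<open>V - A\<close>.\<close>

lemma hcochains_insert:
  assumes "f \<in> hcochains V F t" "\<And>s. set s \<subseteq> V - A \<Longrightarrow> f s = 0"
  shows "f \<in> hcochains V (insert A F) t"
  using assms unfolding hcochains_def hits_insert by fastforce

lemma hcochains_insertD:
  assumes "f \<in> hcochains V (insert A F) t" "set s \<subseteq> V - A"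
  shows "f s = 0"
  using assms unfolding hcochains_def hits_insert by auto

lemma exact_at_cong_hits:
  assumes "\<And>s. set s \<subseteq> V \<Longrightarrow> hits F s \<longleftrightarrow> hits G s"
  shows "exact_at K V F t \<longleftrightarrow> exact_at K V G t"
proof -
  have "hcochains V F u = (hcochains V G u :: ('a list \<Rightarrow> 'b) set)" for u
    unfolding hcochains_def using assms by blast
  then show ?thesis unfolding exact_at_def by simp
qed

text \<open>Prepending \<open>v\<close> is a contracting homotopy: \<open>v\<close> contributes to
  no hit, so the tail alone must hit \<open>F\<close>, and the cocycle condition at
  \<open>v # s\<close> expresses \<open>f s\<close> as a coboundary.\<close>

lemma exact_at_cone:
  assumes "v \<in> V" "v \<notin> \<Union>F"
  shows "exact_at (K :: 'k::ab_group_add itself) V F t"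
  unfolding exact_at_def
proof (intro allI impI)
  fix f :: "'a list \<Rightarrow> 'k"
  assume f: "f \<in> hcochains V F t" and coc: "\<forall>s. set s \<subseteq> V \<longrightarrow> cobd f s = 0"
  have "(\<lambda>s. f (v # s)) \<in> hcochains V F (t - 1)"
    unfolding hcochains_def
  proof (intro CollectI allI impI)
    fix s assume "set s \<subseteq> V" "f (v # s) \<noteq> 0"
    then have "int (length (v # s)) = t \<and> hits F (v # s)"
      using assms(1) by (intro hcochainsD[OF f]) auto
    then show "int (length s) = t - 1 \<and> hits F s"
      using assms(2) unfolding hits_def by auto
  qed
  moreover have "f s = cobd (\<lambda>s. f (v # s)) s" if "set s \<subseteq> V" for s
    using coc[rule_format, of "v # s"] that assms(1) by simp
  ultimately show "\<exists>g\<in>hcochains V F (t - 1). \<forall>s. set s \<subseteq> V \<longrightarrow> f s = cobd g s"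
    by blast
qed

text \<open>The only tuple is \<open>[]\<close>, which hits no set, so every cochain is
  zero.\<close>

lemma exact_at_empty_nonempty: "F \<noteq> {} \<Longrightarrow> exact_at K {} F t"
  unfolding exact_at_def hcochains_def hits_def by (fastforce intro: exI[of _ "\<lambda>s. 0"])

text \<open>Only \<open>[]\<close> exists and nothing has to be hit: the complex is one copy of the
  coefficients in length 0.\<close>

lemma exact_at_empty_empty:
  "exact_at (K :: 'k::{ab_group_add, zero_neq_one} itself) {} {} t \<longleftrightarrow> t \<noteq> 0"
proof
  assume *: "exact_at K {} {} t"
  show "t \<noteq> 0"
  proof
    assume "t = 0"
    then have "(\<lambda>s. 1 :: 'k) \<in> hcochains {} {} t"
      by (simp add: hcochains_def hits_def)
    then show False
      using * unfolding exact_at_def by fastforce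
  qed
next
  assume "t \<noteq> 0"
  then show "exact_at K {} {} t"
    unfolding exact_at_def hcochains_def hits_def by (fastforce intro: exI[of _ "\<lambda>s. 0"])
qed

text \<open>In the long exact sequence, the group of \<open>insert A F\<close> at \<open>t\<close>
  lies between that of \<open>V - A\<close> at \<open>t - 1\<close> and that of \<open>V\<close> at
  \<open>t\<close>; both vanish. The proof is the explicit diagram chase.\<close>

lemma exact_at_insert:
  fixes K :: "'k::ab_group_add itself"
  assumes V: "exact_at K V F t" and VA: "exact_at K (V - A) F (t - 1)"
  shows "exact_at K V (insert A F) t"
  unfolding exact_at_def
proof (intro allI impI)
  fix f :: "'a list \<Rightarrow> 'k"
  assume f: "f \<in> hcochains V (insert A F) t" and coc: "\<forall>s. set s \<subseteq> V \<longrightarrow> cobd f s = 0"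
  have "f \<in> hcochains V F t"
    using f hcochains_subset[of V V F "insert A F"] by blast
  with V coc obtain g where g: "g \<in> hcochains V F (t - 1)"
    and fg: "\<And>s. set s \<subseteq> V \<Longrightarrow> f s = cobd g s"
    unfolding exact_at_def by blast
  have "g \<in> hcochains (V - A) F (t - 1)"
    using g hcochains_subset[of "V - A" V F F] by blast
  moreover have "cobd g s = 0" if "set s \<subseteq> V - A" for s
    using fg[of s] hcochains_insertD[OF f that] that by auto
  ultimately obtain h where h: "h \<in> hcochains (V - A) F (t - 1 - 1)"
    and gh: "\<And>s. set s \<subseteq> V - A \<Longrightarrow> g s = cobd h s"
    using VA unfolding exact_at_def by blast
  \<comment> \<open>Extension by zero lifts \<open>h\<close> to \<open>V\<close>. Subtracting
    \<open>cobd h'\<close> makes the primitive vanish on tuples avoiding \<open>A\<close> and leaves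
    its coboundary unchanged.\<close>
  define h' where "h' = (\<lambda>s. if set s \<subseteq> V - A then h s else 0)"
  define w where "w = (\<lambda>s. g s - cobd h' s)"
  have "cobd h' \<in> hcochains V F (t - 1)"
    using hcochains_cobd[OF hcochains_extend[OF h, of V]] by (simp add: h'_def)
  then have "w \<in> hcochains V F (t - 1)"
    unfolding w_def by (intro hcochains_diff g)
  moreover have "w s = 0" if "set s \<subseteq> V - A" for s
  proof -
    have "cobd h' s = cobd h s"
      using that by (intro cobd_cong) (auto simp: h'_def)
    then show ?thesis by (simp add: w_def gh that)
  qed
  ultimately have "w \<in> hcochains V (insert A F) (t - 1)"
    by (rule hcochains_insert)
  moreover have "f s = cobd w s" if "set s \<subseteq> V" for s
    unfolding w_def by (simp add: cobd_diff cobd_cobd fg that)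
  ultimately show "\<exists>g\<in>hcochains V (insert A F) (t - 1). \<forall>s. set s \<subseteq> V \<longrightarrow> f s = cobd g s"
    by blast
qed

text \<open>The neighbouring piece of the same sequence: the group of \<open>V - A\<close> at
  \<open>t - 1\<close> lies between that of \<open>V\<close> at \<open>t - 1\<close> and that of
  \<open>insert A F\<close> at \<open>t\<close>. The connecting map extends by zero and applies
  \<open>cobd\<close>.\<close>

lemma exact_at_remove:
  fixes K :: "'k::ab_group_add itself"
  assumes VA: "exact_at K V (insert A F) t" and V: "exact_at K V F (t - 1)"
  shows "exact_at K (V - A) F (t - 1)"
  unfolding exact_at_def
proof (intro allI impI)
  fix g :: "'a list \<Rightarrow> 'k"
  assume g: "g \<in> hcochains (V - A) F (t - 1)"
    and coc: "\<forall>s. set s \<subseteq> V - A \<longrightarrow> cobd g s = 0"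
  define g' where "g' = (\<lambda>s. if set s \<subseteq> V - A then g s else 0)"
  have g': "g' \<in> hcochains V F (t - 1)"
    unfolding g'_def by (rule hcochains_extend[OF g])
  have "cobd g' s = 0" if "set s \<subseteq> V - A" for s
  proof -
    have "cobd g' s = cobd g s"
      using that by (intro cobd_cong) (auto simp: g'_def)
    then show ?thesis using coc that by simp
  qed
  moreover have "cobd g' \<in> hcochains V F t"
    using hcochains_cobd[OF g'] by simp
  ultimately have "cobd g' \<in> hcochains V (insert A F) t"
    by (intro hcochains_insert)
  with VA obtain w where w: "w \<in> hcochains V (insert A F) (t - 1)"
    and gw: "\<And>s. set s \<subseteq> V \<Longrightarrow> cobd g' s = cobd w s"
    unfolding exact_at_def using cobd_cobd by blast
  have "w \<in> hcochains V F (t - 1)"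
    using w hcochains_subset[of V V F "insert A F"] by blast
  \<comment> \<open>\<open>w\<close> vanishes on tuples avoiding \<open>A\<close>, so
    \<open>g' - w\<close> is a cocycle on all of \<open>V\<close> that still restricts to
    \<open>g\<close>.\<close>
  then have "(\<lambda>s. g' s - w s) \<in> hcochains V F (t - 1)"
    by (rule hcochains_diff[OF g'])
  moreover have "\<forall>s. set s \<subseteq> V \<longrightarrow> cobd (\<lambda>s. g' s - w s) s = 0"
    by (simp add: cobd_diff gw)
  ultimately obtain u where u: "u \<in> hcochains V F (t - 1 - 1)"
    and gu: "\<And>s. set s \<subseteq> V \<Longrightarrow> g' s - w s = cobd u s"
    using V unfolding exact_at_def by blast
  have "u \<in> hcochains (V - A) F (t - 1 - 1)"
    using u hcochains_subset[of "V - A" V F F] by blast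
  moreover have "g s = cobd u s" if "set s \<subseteq> V - A" for s
  proof -
    have "g' s = g s" "w s = 0" "set s \<subseteq> V"
      using that hcochains_insertD[OF w that] by (auto simp: g'_def)
    then show ?thesis using gu[of s] by simp
  qed
  ultimately show "\<exists>h\<in>hcochains (V - A) F (t - 1 - 1). \<forall>s. set s \<subseteq> V - A \<longrightarrow> g s = cobd h s"
    by blast
qed

text \<open>With nothing to hit, the complex is acyclic by the cone, so removing \<open>UNIV\<close>
  shifts the question to the empty chart set. The exception \<open>t = 1\<close> is Cech degree 0,
  the constants.\<close>

lemma exact_at_UNIV:
  assumes "V \<noteq> {}"
  shows "exact_at (K :: 'k::{ab_group_add, zero_neq_one} itself) (V :: 'a set) {UNIV} t \<longleftrightarrow> t \<noteq> 1"
proof -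
  have acyclic: "exact_at K V {} u" for u
    using assms exact_at_cone[of _ V "{}"] by blast
  have "exact_at K V {UNIV} t \<longleftrightarrow> exact_at K ({} :: 'a set) {} (t - 1)"
    using exact_at_insert[OF acyclic, of UNIV] exact_at_remove[OF _ acyclic, of UNIV] by auto
  then show ?thesis by (simp add: exact_at_empty_empty)
qed

section \<open>Products of projective spaces\<close>

definition box :: "('r \<Rightarrow> nat set) \<Rightarrow> ('r \<Rightarrow> nat) set" where
  "box W = {\<sigma>. \<forall>k. \<sigma> k \<in> W k}"

text \<open>The slice of \<open>(k, i)\<close> consists of the charts on which the coordinate
  \<open>x k i\<close> is invertible.\<close>

definition slices :: "('r \<Rightarrow> nat set) \<Rightarrow> ('r \<Rightarrow> nat) set set" where
  "slices N = (\<lambda>(k, i). {\<sigma>. \<sigma> k = i}) ` Sigma UNIV N"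

lemma slices_eq_empty_iff: "slices N = {} \<longleftrightarrow> (\<forall>k. N k = {})"
  unfolding slices_def by auto

lemma hits_slices: "hits (slices N) s \<longleftrightarrow> (\<forall>k. \<forall>i\<in>N k. \<exists>\<sigma>\<in>set s. \<sigma> k = i)"
  unfolding hits_def slices_def by (simp add: split_beta disjoint_iff Bex_def)

lemma slices_remove:
  assumes "i \<in> N k"
  shows "slices N = insert {\<sigma>. \<sigma> k = i} (slices (N(k := N k - {i})))"
proof -
  have "Sigma UNIV N = insert (k, i) (Sigma UNIV (N(k := N k - {i})))"
    using assms by (auto split: if_splits)
  then show ?thesis unfolding slices_def by simp
qed

lemma box_remove: "box W - {\<sigma>. \<sigma> k = i} = box (W(k := W k - {i}))"
  unfolding box_def by auto

lemma sum_card_remove_less: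
  fixes N :: "'r::finite \<Rightarrow> nat set"
  assumes "k \<in> J" "i \<in> N k" "finite (N k)"
  shows "(\<Sum>j\<in>J. card ((N(k := N k - {i})) j)) < (\<Sum>j\<in>J. card (N j))"
proof (rule sum_strict_mono_ex1)
  have "card (N k - {i}) < card (N k)"
    using assms(3,2) by (rule card_Diff1_less)
  then show "\<exists>j\<in>J. card ((N(k := N k - {i})) j) < card (N j)"
    using assms(1) by (intro bexI[of _ k]) simp_all
  from \<open>card (N k - {i}) < card (N k)\<close>
  show "\<forall>j\<in>J. card ((N(k := N k - {i})) j) \<le> card (N j)"
    by simp
qed simp

text \<open>The coordinate \<open>i0\<close> of factor \<open>k'\<close> need not be hit. Slices of
  the other factors are removed by induction, which keeps \<open>i0\<close> available; when only
  factor \<open>k'\<close> has slices left, a chart with value \<open>i0\<close> there lies in none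
  of them and is a cone vertex.\<close>

lemma exact_at_slices_proper:
  fixes N W :: "'r::finite \<Rightarrow> nat set"
  assumes "\<And>k. finite (N k)" "N k' \<noteq> {}" "i0 \<in> W k'" "i0 \<notin> N k'"
  shows "exact_at K (box W) (slices N) t"
  using assms
proof (induction "\<Sum>k\<in>-{k'}. card (N k)" arbitrary: N W t rule: less_induct)
  case (less N W t)
  show ?case
  proof (cases "\<exists>k. k \<noteq> k' \<and> N k \<noteq> {}")
    case True
    then obtain k i where k: "k \<noteq> k'" "i \<in> N k" by blast
    let ?N = "N(k := N k - {i})"
    have "(\<Sum>j\<in>-{k'}. card (?N j)) < (\<Sum>j\<in>-{k'}. card (N j))"
      using k less.prems(1) by (intro sum_card_remove_less) auto
    note IH = less.hyps[OF this]
    have "exact_at K (box W) (slices ?N) t"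
      by (rule IH) (use less.prems k in auto)
    moreover have "exact_at K (box W - {\<sigma>. \<sigma> k = i}) (slices ?N) (t - 1)"
      unfolding box_remove by (rule IH) (use less.prems k in auto)
    ultimately have "exact_at K (box W) (insert {\<sigma>. \<sigma> k = i} (slices ?N)) t"
      by (rule exact_at_insert)
    moreover have "slices N = insert {\<sigma>. \<sigma> k = i} (slices ?N)"
      using k(2) by (rule slices_remove)
    ultimately show ?thesis by (simp only:)
  next
    case no_other: False
    show ?thesis
    proof (cases "box W = {}")
      \<comment> \<open>Earlier removals may have emptied a factor of \<open>W\<close>. No cone
        vertex exists then, but the slices of \<open>k'\<close> still have to be hit.\<close>
      case True
      moreover have "slices N \<noteq> {}" using less.prems(2) by (auto simp: slices_eq_empty_iff)
      ultimately show ?thesis by (simp add: exact_at_empty_nonempty)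
    next
      case False
      then obtain \<sigma> where "\<sigma> \<in> box W" by blast
      then have "\<sigma>(k' := i0) \<in> box W"
        using less.prems by (auto simp: box_def)
      moreover have "\<sigma>(k' := i0) \<notin> \<Union>(slices N)"
      proof -
        have "(\<sigma>(k' := i0)) k \<notin> N k" for k
          using no_other less.prems(4) by (cases "k = k'") auto
        then show ?thesis unfolding slices_def by simp
      qed
      ultimately show ?thesis by (rule exact_at_cone)
    qed
  qed
qed

text \<open>The condition to hit \<open>UNIV\<close> excludes the empty tuple, which would augment the complex.\<close>

lemma exact_at_insert_UNIV:
  assumes "F \<noteq> {}"
  shows "exact_at K V (insert UNIV F) t \<longleftrightarrow> exact_at K V F t"
  using assms by (intro exact_at_cong_hits) (auto simp: hits_def)

text \<open>Dropping the requirement to hit one slice of a factor with at least two coordinates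
  gives an exact complex, so removing that coordinate shifts the degree by one. Factor
  \<open>k\<close> in \<open>J\<close> thus contributes \<open>card (W k) - 1\<close> shifts, until
  each factor in \<open>J\<close> is a single point and every nonempty tuple hits its slice.\<close>

lemma exact_at_slices_full:
  fixes W :: "'r::finite \<Rightarrow> nat set" and K :: "'k::{ab_group_add, zero_neq_one} itself"
  assumes "\<And>k. finite (W k)" "\<And>k. W k \<noteq> {}"
  shows "exact_at K (box W) (insert UNIV (slices (\<lambda>k. if k \<in> J then W k else {}))) t \<longleftrightarrow>
         t \<noteq> 1 + (\<Sum>k\<in>J. int (card (W k)) - 1)"
  using assms
proof (induction "\<Sum>k\<in>J. card (W k)" arbitrary: W t rule: less_induct)
  case (less W t)
  let ?N = "\<lambda>W k. if k \<in> J then W k else {}"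
  show ?case
  proof (cases "\<exists>k\<in>J. card (W k) \<noteq> 1")
    case True
    then obtain k where k: "k \<in> J" "card (W k) \<noteq> 1" by blast
    then have card: "card (W k) \<ge> 2"
      using less.prems[of k] by (metis One_nat_def Suc_1 Suc_leI card_gt_0_iff le_neq_implies_less)
    obtain i where i: "i \<in> W k" using less.prems(2) by blast
    let ?W = "W(k := W k - {i})"
    have ne: "W k - {i} \<noteq> {}"
      using card i by (metis card_Suc_Diff1 card.empty Suc_1 not_less_eq_eq
          le_0_eq nat.simps(3) One_nat_def less.prems(1))
    have N: "(?N W)(k := ?N W k - {i}) = ?N ?W"
      using k(1) by (intro ext) simp
    have sl: "insert UNIV (slices (?N W)) = insert {\<sigma>. \<sigma> k = i} (insert UNIV (slices (?N ?W)))"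
      using slices_remove[of i "?N W" k] i k(1) unfolding N by (simp add: insert_commute)
    have "slices (?N ?W) \<noteq> {}" using ne k by (auto simp: slices_eq_empty_iff)
    \<comment> \<open>The coordinate \<open>i\<close> is still in \<open>W k\<close> but no longer
      has to be hit.\<close>
    moreover have "exact_at K (box W) (slices (?N ?W)) u" for u
      by (rule exact_at_slices_proper[of _ k i]) (use less.prems k ne i in auto)
    ultimately have ex: "exact_at K (box W) (insert UNIV (slices (?N ?W))) u" for u
      by (simp add: exact_at_insert_UNIV)
    have dec: "(\<Sum>j\<in>J. card (?W j)) < (\<Sum>j\<in>J. card (W j))"
      using k(1) i less.prems(1) by (rule sum_card_remove_less)
    have "exact_at K (box W) (insert UNIV (slices (?N W))) t \<longleftrightarrow>
          exact_at K (box ?W) (insert UNIV (slices (?N ?W))) (t - 1)"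
      using exact_at_insert[OF ex, of "{\<sigma>. \<sigma> k = i}" t] exact_at_remove[OF _ ex, of "{\<sigma>. \<sigma> k = i}" t]
      unfolding sl box_remove[of W k i] by (rule iffI[rotated])
    also have "\<dots> \<longleftrightarrow> t - 1 \<noteq> 1 + (\<Sum>j\<in>J. int (card (?W j)) - 1)"
      by (rule less.hyps[OF dec]) (use less.prems ne in auto)
    also have "(\<Sum>j\<in>J. int (card (?W j)) - 1) = (\<Sum>j\<in>J. int (card (W j)) - 1) - 1"
    proof -
      have "int (card (W k - {i})) = int (card (W k)) - 1"
        using i card by (simp add: card_Diff_singleton)
      moreover have "(\<Sum>j\<in>J - {k}. int (card (?W j)) - 1) = (\<Sum>j\<in>J - {k}. int (card (W j)) - 1)"
        by (intro sum.cong) auto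
      ultimately show ?thesis
        using sum.remove[OF _ k(1), of "\<lambda>j. int (card (?W j)) - 1"]
          sum.remove[OF _ k(1), of "\<lambda>j. int (card (W j)) - 1"] by simp
    qed
    finally show ?thesis by auto
  next
    case False
    have "(\<lambda>k. SOME i. i \<in> W k) \<in> box W"
      using less.prems(2) by (simp add: box_def some_in_eq)
    then have V: "box W \<noteq> {}" by blast
    have single: "\<exists>i. W k = {i}" if "k \<in> J" for k
      using False that by (metis card_1_singletonE)
    have "hits (insert UNIV (slices (?N W))) s \<longleftrightarrow> hits {UNIV} s" if s: "set s \<subseteq> box W" for s
    proof -
      have "\<exists>\<sigma>\<in>set s. \<sigma> k = i" if "s \<noteq> []" "k \<in> J" "i \<in> W k" for k i
      proof -
        have "hd s \<in> box W" "hd s \<in> set s" using s that(1) by auto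
        then show ?thesis using single[OF that(2)] that(3) by (fastforce simp: box_def)
      qed
      then show ?thesis by (auto simp: hits_insert hits_slices hits_UNIV hits_empty split: if_splits)
    qed
    then have "exact_at K (box W) (insert UNIV (slices (?N W))) t \<longleftrightarrow> exact_at K (box W) {UNIV} t"
      by (rule exact_at_cong_hits)
    then show ?thesis using V False by (simp add: exact_at_UNIV)
  qed
qed

section \<open>From monomials to Cech cohomology\<close>

definition monomials :: "('r \<Rightarrow> nat) \<Rightarrow> ('r \<Rightarrow> int) \<Rightarrow> 'r expo set" where
  "monomials l a = {e. (\<forall>k i. l k < i \<longrightarrow> e k i = 0) \<and> (\<forall>k. (\<Sum>i\<le>l k. e k i) = a k)}"

text \<open>A tuple hits these sets when it is nonempty and the monomial \<open>e\<close> is regular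
  on the intersection of its charts. \<open>UNIV\<close> bars the empty tuple even if
  \<open>e\<close> has no negative exponent.\<close>

definition neg_slices :: "'r expo \<Rightarrow> ('r \<Rightarrow> nat) set set" where
  "neg_slices e = insert UNIV (slices (\<lambda>k. {i. e k i < 0}))"

lemma hits_neg_slices:
  "hits (neg_slices e) s \<longleftrightarrow> s \<noteq> [] \<and> (\<forall>k i. e k i < 0 \<longrightarrow> (\<exists>\<sigma>\<in>set s. \<sigma> k = i))"
  unfolding neg_slices_def hits_insert hits_slices by auto

lemma mem_sections:
  assumes "s \<noteq> []"
  shows "f \<in> sections l a (set s) \<longleftrightarrow>
    (\<forall>e. Poly_Mapping.lookup f e \<noteq> 0 \<longrightarrow> e \<in> monomials l a \<and> hits (neg_slices e) s)"
  using assms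
  by (simp only: sections_def monomials_def hits_neg_slices in_keys_iff Ball_def mem_Collect_eq
      conj_assoc simp_thms)

lemma cover_eq_box: "cover l = box (\<lambda>k. {..l k})"
  unfolding cover_def box_def by auto

lemma finite_cover: "finite (cover (l :: 'r::finite \<Rightarrow> nat))"
proof -
  have "cover l \<subseteq> PiE UNIV (\<lambda>k. {..l k})" by (auto simp: cover_def PiE_def)
  then show ?thesis using finite_PiE[of UNIV "\<lambda>k. {..l k}"] finite_subset by auto
qed

lemma finite_simplices: "finite (simplices (l :: 'r::finite \<Rightarrow> nat) q)"
proof -
  have "simplices l q \<subseteq> {s. set s \<subseteq> cover l \<and> length s = nat (q + 1)}"
    unfolding simplices_def by auto
  then show ?thesis using finite_lists_length_eq[OF finite_cover] finite_subset by blast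
qed

lemma coboundary_eq: "coboundary l q c s = (if s \<in> simplices l (q + 1) then cobd c s else 0)"
  unfolding coboundary_def cobd_conv_sum by simp

lemma cochains_iff:
  "c \<in> cochains l q a \<longleftrightarrow> (\<forall>s. s \<notin> simplices l q \<longrightarrow> c s = 0) \<and>
     (\<forall>s e. Poly_Mapping.lookup (c s) e \<noteq> 0 \<longrightarrow> e \<in> monomials l a \<and> hits (neg_slices e) s)"
proof -
  let ?P = "\<lambda>s. \<forall>e. Poly_Mapping.lookup (c s) e \<noteq> 0 \<longrightarrow> e \<in> monomials l a \<and> hits (neg_slices e) s"
  have "c s \<in> sections l a (set s) \<longleftrightarrow> ?P s" if "s \<in> simplices l q" for s
    using that by (intro mem_sections) (simp add: simplices_def)
  moreover have "?P s" if "c s = 0" for s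
    using that by simp
  ultimately show ?thesis
    unfolding cochains_def mem_Collect_eq by meson
qed

lemma lookup_cochain:
  assumes "c \<in> cochains l q a"
  shows "(\<lambda>s. Poly_Mapping.lookup (c s) e) \<in> hcochains V (neg_slices e) (q + 1)"
  unfolding hcochains_def
proof (intro CollectI allI impI)
  fix s assume s: "Poly_Mapping.lookup (c s) e \<noteq> 0"
  then have "c s \<noteq> 0" by auto
  then have "s \<in> simplices l q" using assms unfolding cochains_iff by blast
  then show "int (length s) = q + 1 \<and> hits (neg_slices e) s"
    using s assms unfolding cochains_iff simplices_def by blast
qed

lemma hcochain_eq_0:
  assumes "f \<in> hcochains (cover l) (neg_slices e) (q + 1)" "set s \<subseteq> cover l" "s \<notin> simplices l q"
  shows "f s = 0"
  using hcochainsD[OF assms(1,2)] assms(2,3) by (auto simp: simplices_def hits_neg_slices)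

lemma cobd_hcochain_eq_0:
  assumes f: "f \<in> hcochains (cover l) (neg_slices e) q" and s: "set s \<subseteq> cover l" "s \<notin> simplices l q"
  shows "cobd f s = 0"
proof (cases "s = []")
  case False
  show ?thesis
  proof (rule cobd_eq_0, rule ccontr)
    fix t assume t: "set t \<subseteq> set s" "Suc (length t) = length s" "f t \<noteq> 0"
    then have "int (length t) = q" using hcochainsD[OF f, of t] s(1) by auto
    then show False using s t False by (auto simp: simplices_def)
  qed
qed simp

lemma monomial_cochain:
  fixes f :: "('r \<Rightarrow> nat) list \<Rightarrow> 'k::ab_group_add"
  assumes "f \<in> hcochains (cover l) (neg_slices e) (q + 1)" "e \<in> monomials l a"
  shows "(\<lambda>s. if s \<in> simplices l q then Poly_Mapping.single e (f s) else 0) \<in> cochains l q a"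
proof -
  have "hits (neg_slices e) s" if "s \<in> simplices l q" "f s \<noteq> 0" for s
    using hcochainsD[OF assms(1) _ that(2)] that(1) by (auto simp: simplices_def)
  then show ?thesis
    using assms(2) unfolding cochains_iff by (auto simp: lookup_single when_def split: if_splits)
qed

text \<open>Multiplying a scalar cocycle by the monomial \<open>e\<close> gives a Cech cocycle; the
  coefficients of \<open>e\<close> in a Cech primitive form a scalar primitive.\<close>

lemma exact_at_if_exact:
  fixes K :: "'k::ab_group_add itself" and l :: "'r \<Rightarrow> nat"
  assumes sub: "(cocycles l q a :: ('r, 'k) cochain set) \<subseteq> coboundaries l q a"
    and e: "e \<in> monomials l a"
  shows "exact_at K (cover l) (neg_slices e) (q + 1)"
  unfolding exact_at_def
proof (intro allI impI)
  fix f :: "('r \<Rightarrow> nat) list \<Rightarrow> 'k"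
  assume f: "f \<in> hcochains (cover l) (neg_slices e) (q + 1)"
    and coc: "\<forall>s. set s \<subseteq> cover l \<longrightarrow> cobd f s = 0"
  define c where "c = (\<lambda>s. if s \<in> simplices l q then Poly_Mapping.single e (f s) else 0)"
  have lookup_c: "Poly_Mapping.lookup (c s) e' = (if e' = e then f s else 0)"
    if "set s \<subseteq> cover l" for s e'
    using hcochain_eq_0[OF f that] by (auto simp: c_def lookup_single when_def)
  have "cobd c s = 0" if s: "set s \<subseteq> cover l" for s
  proof (rule poly_mapping_eqI)
    fix e'
    have "cobd (\<lambda>t. Poly_Mapping.lookup (c t) e') s = cobd (\<lambda>t. if e' = e then f t else 0) s"
      using s by (intro cobd_cong) (auto simp: lookup_c)
    then show "Poly_Mapping.lookup (cobd c s) e' = Poly_Mapping.lookup 0 e'"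
      using coc s by (cases "e' = e") (simp_all add: lookup_cobd cobd_zero)
  qed
  moreover have "c \<in> cochains l q a"
    unfolding c_def by (rule monomial_cochain[OF f e])
  ultimately have "c \<in> cocycles l q a"
    by (simp add: cocycles_def coboundary_eq simplices_def)
  then obtain g where g: "g \<in> cochains l (q - 1) a" "c = coboundary l (q - 1) g"
    using sub unfolding coboundaries_def by blast
  let ?g = "\<lambda>s. Poly_Mapping.lookup (g s) e"
  have g_e: "?g \<in> hcochains (cover l) (neg_slices e) q"
    using lookup_cochain[OF g(1)] by simp
  have "f s = cobd ?g s" if s: "set s \<subseteq> cover l" for s
  proof (cases "s \<in> simplices l q")
    case True
    then have "c s = cobd g s" using g(2) by (simp add: coboundary_eq)
    then show ?thesis using lookup_c[OF s, of e] by (simp add: lookup_cobd)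
  next
    case False
    then show ?thesis using hcochain_eq_0[OF f s] cobd_hcochain_eq_0[OF g_e s] by simp
  qed
  then show "\<exists>g\<in>hcochains (cover l) (neg_slices e) (q + 1 - 1).
      \<forall>s. set s \<subseteq> cover l \<longrightarrow> f s = cobd g s"
    using g_e by auto
qed

text \<open>Each monomial's coefficients form a scalar cocycle. Primitives are chosen monomial by
  monomial and reassembled.\<close>

lemma exact_if_exact_at:
  fixes K :: "'k::ab_group_add itself" and l :: "'r::finite \<Rightarrow> nat"
  assumes ex: "\<And>e. e \<in> monomials l a \<Longrightarrow> exact_at K (cover l) (neg_slices e) (q + 1)"
  shows "(cocycles l q a :: ('r, 'k) cochain set) \<subseteq> coboundaries l q a"
proof
  fix c :: "('r, 'k) cochain"
  assume c: "c \<in> cocycles l q a"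
  then have cc: "c \<in> cochains l q a" and coc: "\<And>s. s \<in> simplices l (q + 1) \<Longrightarrow> cobd c s = 0"
    unfolding cocycles_def coboundary_eq by (auto split: if_splits)
  let ?c = "\<lambda>e s. Poly_Mapping.lookup (c s) e"
  have "\<exists>g \<in> hcochains (cover l) (neg_slices e) q. \<forall>s. set s \<subseteq> cover l \<longrightarrow> ?c e s = cobd g s"
    if "e \<in> monomials l a" for e
  proof -
    have f: "?c e \<in> hcochains (cover l) (neg_slices e) (q + 1)"
      by (rule lookup_cochain[OF cc])
    have "cobd (?c e) s = 0" if s: "set s \<subseteq> cover l" for s
      using cobd_hcochain_eq_0[OF f s] coc[of s] by (cases "s \<in> simplices l (q + 1)") (auto simp flip: lookup_cobd)
    then show ?thesis using ex[OF that] f unfolding exact_at_def by force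
  qed
  then obtain G where G: "\<And>e. e \<in> monomials l a \<Longrightarrow> G e \<in> hcochains (cover l) (neg_slices e) q"
    and cG: "\<And>e s. e \<in> monomials l a \<Longrightarrow> set s \<subseteq> cover l \<Longrightarrow> ?c e s = cobd (G e) s"
    by metis
  \<comment> \<open>There are finitely many simplices, each carrying a finite support, so the sum of
    primitives over \<open>E\<close> is a Laurent polynomial. Outside \<open>E\<close> the
    coefficients of \<open>c\<close> vanish and the zero primitive serves.\<close>
  define E where "E = (\<Union>s\<in>simplices l q. Poly_Mapping.keys (c s))"
  have "finite E" unfolding E_def by (simp add: finite_simplices)
  have E: "e \<in> monomials l a" if "e \<in> E" for e
    using that cc unfolding E_def cochains_iff by (auto simp: in_keys_iff)
  define g where "g = (\<lambda>s. if s \<in> simplices l (q - 1)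
    then \<Sum>e\<in>E. Poly_Mapping.single e (G e s) else 0)"
  have lookup_g: "Poly_Mapping.lookup (g s) e = (if e \<in> E \<and> s \<in> simplices l (q - 1) then G e s else 0)"
    for s e
    using \<open>finite E\<close> by (simp add: g_def lookup_sum lookup_single when_def)
  have "hits (neg_slices e) s" if "e \<in> E" "s \<in> simplices l (q - 1)" "G e s \<noteq> 0" for e s
    using hcochainsD[OF G[OF E[OF that(1)]] _ that(3)] that(2) by (auto simp: simplices_def)
  then have "g \<in> cochains l (q - 1) a"
    using E unfolding cochains_iff lookup_g by (auto simp: g_def split: if_splits)
  moreover have "c = coboundary l (q - 1) g"
  proof
    fix s
    show "c s = coboundary l (q - 1) g s"
    proof (cases "s \<in> simplices l q")
      case True
      then have s: "set s \<subseteq> cover l" by (simp add: simplices_def)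
      have "?c e s = cobd (\<lambda>t. Poly_Mapping.lookup (g t) e) s" for e
      proof (cases "e \<in> E")
        case e: True
        have "cobd (\<lambda>t. Poly_Mapping.lookup (g t) e) s = cobd (G e) s"
        proof (rule cobd_cong)
          fix t assume "set t \<subseteq> set s"
          then have "set t \<subseteq> cover l" using s by blast
          then show "Poly_Mapping.lookup (g t) e = G e t"
            using hcochain_eq_0[of "G e" l e "q - 1" t] G[OF E[OF e]] e by (auto simp: lookup_g)
        qed
        then show ?thesis using cG[OF E[OF e] s] by simp
      next
        case False
        then have "?c e s = 0" using True by (auto simp: E_def in_keys_iff)
        then show ?thesis using False by (simp add: lookup_g cobd_zero)
      qed
      then show ?thesis
        using True by (auto intro!: poly_mapping_eqI simp: coboundary_eq lookup_cobd)
    next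
      case False
      then show ?thesis using cc by (simp add: coboundary_eq cochains_iff)
    qed
  qed
  ultimately show "c \<in> coboundaries l q a"
    unfolding coboundaries_def by blast
qed

section \<open>Vanishing of the cohomology quotient\<close>

lemma zero_cochain: "(\<lambda>s. 0) \<in> cochains l q a"
  unfolding cochains_iff by simp

lemma cochains_diff:
  fixes c c' :: "('r, 'k::ab_group_add) cochain"
  assumes "c \<in> cochains l q a" "c' \<in> cochains l q a"
  shows "c - c' \<in> cochains l q a"
  unfolding cochains_iff
proof (intro conjI allI impI)
  fix s e assume "Poly_Mapping.lookup ((c - c') s) e \<noteq> 0"
  then have "Poly_Mapping.lookup (c s) e \<noteq> 0 \<or> Poly_Mapping.lookup (c' s) e \<noteq> 0"
    by (auto simp: lookup_minus)
  then show "e \<in> monomials l a" "hits (neg_slices e) s"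
    using assms unfolding cochains_iff by blast+
qed (use assms in \<open>simp add: cochains_iff\<close>)

lemma zero_cocycle: "(\<lambda>s. 0) \<in> cocycles l q a"
  unfolding cocycles_def by (simp add: zero_cochain coboundary_eq cobd_zero)

lemma cocycles_diff:
  fixes c c' :: "('r, 'k::ab_group_add) cochain"
  assumes "c \<in> cocycles l q a" "c' \<in> cocycles l q a"
  shows "c - c' \<in> cocycles l q a"
proof -
  have "c - c' = (\<lambda>t. c t - c' t)" by auto
  then have "coboundary l q (c - c') s = coboundary l q c s - coboundary l q c' s" for s
    by (simp add: coboundary_eq cobd_diff)
  then show ?thesis using assms cochains_diff unfolding cocycles_def by auto
qed

lemma zero_coboundary: "(\<lambda>s. 0) \<in> coboundaries l q a"
  unfolding coboundaries_def
  by (rule image_eqI[OF _ zero_cochain]) (simp add: fun_eq_iff coboundary_eq cobd_zero)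

lemma cohomology_nonempty: "cohomology l q a \<noteq> {}"
  unfolding cohomology_def quotient_def using zero_cocycle by blast

text \<open>A single class puts every cocycle in the class of zero. Conversely, differences of
  cocycles are cocycles, so the inclusion makes any two of them equivalent.\<close>

lemma vanishes_cohomology_iff_exact:
  "vanishes (cohomology l q a :: ('r, 'k::ab_group_add) cochain set set) \<longleftrightarrow>
   (cocycles l q a :: ('r, 'k) cochain set) \<subseteq> coboundaries l q a"
proof -
  let ?Z = "cocycles l q a :: ('r, 'k) cochain set" and ?B = "coboundaries l q a :: ('r, 'k) cochain set"
  let ?R = "{(c, c'). c \<in> ?Z \<and> c' \<in> ?Z \<and> c - c' \<in> ?B}"
  have zero: "(\<lambda>s. 0) \<in> ?Z" by (rule zero_cocycle)
  show ?thesis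
  proof
    assume "vanishes (cohomology l q a :: ('r, 'k) cochain set set)"
    then obtain X where X: "?Z // ?R = {X}"
      unfolding vanishes_def cohomology_def by (rule is_singletonE)
    show "?Z \<subseteq> ?B"
    proof
      fix c assume c: "c \<in> ?Z"
      have "?R `` {c} = ?R `` {\<lambda>s. 0}"
        using X quotientI[OF c, of ?R] quotientI[OF zero, of ?R] by simp
      moreover have "(\<lambda>s. 0) \<in> ?R `` {\<lambda>s. 0}"
        using zero zero_coboundary by (simp add: fun_diff_def)
      ultimately have "(\<lambda>s. 0) \<in> ?R `` {c}" by (simp only:)
      then show "c \<in> ?B" by (simp add: fun_diff_def)
    qed
  next
    assume sub: "?Z \<subseteq> ?B"
    then have "?R `` {c} = ?Z" if "c \<in> ?Z" for c
      using that cocycles_diff by blast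
    then have "?Z // ?R = {?Z}" using zero unfolding quotient_def by blast
    then show "vanishes (cohomology l q a :: ('r, 'k) cochain set set)"
      unfolding vanishes_def cohomology_def by simp
  qed
qed

lemma vanishes_cohomology_iff_monomials:
  fixes l :: "'r::finite \<Rightarrow> nat"
  shows "vanishes (cohomology l q a :: ('r, 'k::ab_group_add) cochain set set) \<longleftrightarrow>
    (\<forall>e\<in>monomials l a. exact_at TYPE('k) (cover l) (neg_slices e) (q + 1))"
  unfolding vanishes_cohomology_iff_exact
  using exact_at_if_exact[of l q a] exact_if_exact_at[of l a "TYPE('k)" q] by blast

text \<open>The only degree in which \<open>O(a)\<close> can have cohomology: by Kuenneth, a factor
  with negative twist contributes its top degree and any other factor contributes 0.\<close>

definition bott_degree :: "('r::finite \<Rightarrow> nat) \<Rightarrow> ('r \<Rightarrow> int) \<Rightarrow> int" where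
  "bott_degree l a = (\<Sum>k\<in>{k. a k < 0}. int (l k))"

text \<open>The nonnegative exponent at \<open>j\<close> supplies a coordinate that need not be hit,
  so monomials of mixed sign in some factor contribute nothing in any degree.\<close>

lemma exact_at_neg_slices_proper:
  fixes l :: "'r::finite \<Rightarrow> nat"
  assumes e: "e \<in> monomials l a" and i: "e k i < 0" and j: "j \<le> l k" "0 \<le> e k j"
  shows "exact_at K (cover l) (neg_slices e) t"
proof -
  let ?N = "\<lambda>k. {i. e k i < 0}"
  have "?N k \<subseteq> {..l k}" for k
    using e unfolding monomials_def by (auto simp: not_less[symmetric])
  then have "finite (?N k)" for k using finite_subset by blast
  then have "exact_at K (cover l) (slices ?N) t"
    unfolding cover_eq_box by (rule exact_at_slices_proper[of _ k j]) (use i j in auto)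
  moreover have "slices ?N \<noteq> {}" using i by (auto simp: slices_eq_empty_iff)
  ultimately show ?thesis by (simp add: neg_slices_def exact_at_insert_UNIV)
qed

lemma exact_at_neg_slices_full:
  fixes l :: "'r::finite \<Rightarrow> nat" and K :: "'k::{ab_group_add, zero_neq_one} itself"
  assumes e: "e \<in> monomials l a" and full: "\<And>k i. a k < 0 \<Longrightarrow> i \<le> l k \<Longrightarrow> e k i < 0"
    and none: "\<And>k i. 0 \<le> a k \<Longrightarrow> 0 \<le> e k i"
  shows "exact_at K (cover l) (neg_slices e) (q + 1) \<longleftrightarrow> q \<noteq> bott_degree l a"
proof -
  have "{i. e k i < 0} = (if k \<in> {k. a k < 0} then {..l k} else {})" for k
  proof (cases "a k < 0")
    case True
    have "i \<le> l k" if "e k i < 0" for i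
      using e that unfolding monomials_def by (force simp: not_less[symmetric])
    then show ?thesis using True full by auto
  next
    case False
    then show ?thesis using none[of k] by (auto simp: not_less)
  qed
  then show ?thesis
    unfolding cover_eq_box neg_slices_def bott_degree_def
    using exact_at_slices_full[of "\<lambda>k. {..l k}" K "{k. a k < 0}" "q + 1"] by simp
qed

text \<open>Only monomials with constant sign in every factor matter, and their signs are those of
  \<open>a\<close>. Such monomials exist exactly when each \<open>a k\<close> is nonnegative or
  below \<open>- int (l k)\<close>, and they contribute in \<open>bott_degree l a\<close>
  alone.\<close>

lemma Bott_Kuenneth_vanishing:
  fixes l :: "'r::finite \<Rightarrow> nat"
  shows "vanishes (cohomology l q a :: ('r, 'k::{ab_group_add, zero_neq_one}) cochain set set) \<longleftrightarrow>
    \<not> ((\<forall>k. 0 \<le> a k \<or> a k < - int (l k)) \<and> q = bott_degree l a)"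
proof -
  let ?ex = "\<lambda>e. exact_at TYPE('k) (cover l) (neg_slices e) (q + 1)"
  have sum: "(\<Sum>i\<le>l k. e k i) = a k" if "e \<in> monomials l a" for e k
    using that unfolding monomials_def by blast
  have ex: "?ex e" if e: "e \<in> monomials l a"
    and not_top: "\<not> ((\<forall>k. 0 \<le> a k \<or> a k < - int (l k)) \<and> q = bott_degree l a)" for e
  proof (cases "\<exists>k i j. e k i < 0 \<and> j \<le> l k \<and> 0 \<le> e k j")
    case True
    then show ?thesis using exact_at_neg_slices_proper[OF e] by blast
  next
    case False
    have full: "e k i < 0" if "a k < 0" "i \<le> l k" for k i
    proof (rule ccontr)
      assume "\<not> e k i < 0"
      with False that have "\<forall>j\<le>l k. 0 \<le> e k j" by (metis not_less)
      then have "0 \<le> (\<Sum>i\<le>l k. e k i)" by (intro sum_nonneg) auto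
      then show False using sum[OF e, of k] that by simp
    qed
    have none: "0 \<le> e k i" if "0 \<le> a k" for k i
    proof (rule ccontr)
      assume "\<not> 0 \<le> e k i"
      with False have "\<forall>j\<le>l k. e k j < 0" by (metis not_less)
      then have "(\<Sum>i\<le>l k. e k i) \<le> (\<Sum>i\<le>l k. - 1)" by (intro sum_mono) force
      then show False using sum[OF e, of k] that by simp
    qed
    have "a k < - int (l k)" if "a k < 0" for k
    proof -
      \<comment> \<open>There are \<open>l k + 1\<close> exponents, each at most -1, so the value
        \<open>- int (l k)\<close> itself is out of reach.\<close>
      have "(\<Sum>i\<le>l k. e k i) \<le> (\<Sum>i\<le>l k. - 1)"
        using full[OF that] by (intro sum_mono) force
      then show ?thesis using sum[OF e, of k] by simp
    qed
    then have "q \<noteq> bott_degree l a" using not_top by (meson not_less)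
    then show ?thesis by (simp add: exact_at_neg_slices_full[OF e full none])
  qed
  have not_ex: "\<exists>e\<in>monomials l a. \<not> ?ex e"
    if a: "\<forall>k. 0 \<le> a k \<or> a k < - int (l k)" and q: "q = bott_degree l a"
  proof -
    \<comment> \<open>In a negative factor all exponents are -1 except that \<open>x k 0\<close>
      takes the remainder \<open>a k + int (l k)\<close>, still negative; in the other factors
      \<open>x k 0\<close> carries the whole degree.\<close>
    define e :: "'r expo" where "e = (\<lambda>k i. if l k < i then 0
      else if i = 0 then (if a k < 0 then a k + int (l k) else a k)
      else if a k < 0 then - 1 else 0)"
    have "(\<Sum>i\<le>l k. e k i) = a k" for k
    proof -
      have "(\<Sum>i\<le>l k. e k i) = e k 0 + (\<Sum>i\<in>{1..l k}. e k i)"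
        by (simp add: atMost_atLeast0 sum.atLeast_Suc_atMost)
      also have "(\<Sum>i\<in>{1..l k}. e k i) = (\<Sum>i\<in>{1..l k}. if a k < 0 then - 1 else 0)"
        by (rule sum.cong) (auto simp: e_def)
      finally show ?thesis by (simp add: e_def)
    qed
    then have e: "e \<in> monomials l a" unfolding monomials_def by (simp add: e_def)
    have "e k i < 0" if "a k < 0" "i \<le> l k" for k i
      using that a[rule_format, of k] by (auto simp: e_def)
    moreover have "0 \<le> e k i" if "0 \<le> a k" for k i
      using that by (auto simp: e_def)
    ultimately show ?thesis using exact_at_neg_slices_full[OF e] q e by blast
  qed
  show ?thesis unfolding vanishes_cohomology_iff_monomials using ex not_ex by blast
qed

section \<open>Terms of the Weyman complex\<close>

lemma vanishes_PiE:
  assumes "\<And>i. i \<in> I \<Longrightarrow> S i \<noteq> {}"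
  shows "vanishes (\<Pi>\<^sub>E i\<in>I. S i) \<longleftrightarrow> (\<forall>i\<in>I. vanishes (S i))"
proof
  assume "vanishes (\<Pi>\<^sub>E i\<in>I. S i)"
  then obtain f where f: "(\<Pi>\<^sub>E i\<in>I. S i) = {f}"
    unfolding vanishes_def by (rule is_singletonE)
  then have "f \<in> extensional I" by (auto simp: PiE_def)
  then have "(\<Pi>\<^sub>E i\<in>I. S i) = {\<lambda>i\<in>I. f i}"
    using f by (simp add: extensional_restrict)
  then show "\<forall>i\<in>I. vanishes (S i)"
    unfolding PiE_eq_singleton vanishes_def by auto
next
  assume "\<forall>i\<in>I. vanishes (S i)"
  then obtain f where "\<forall>i\<in>I. S i = {f i}"
    unfolding vanishes_def is_singleton_def by metis
  then show "vanishes (\<Pi>\<^sub>E i\<in>I. S i)"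
    unfolding vanishes_def PiE_eq_singleton[symmetric] by simp
qed

text \<open>In this range the binomial coefficient is positive, so at least one copy of the
  cohomology group is present.\<close>

lemma vanishes_weyman_summand:
  assumes "p \<le> total_dim l + 1"
  shows "vanishes (weyman_summand l d m \<nu> p :: (nat \<Rightarrow> ('r::finite, 'k::ab_group_add) cochain set) set) \<longleftrightarrow>
    vanishes (cohomology l (int p - \<nu>) (twist d m p) :: ('r, 'k) cochain set set)"
proof -
  have "{..<(total_dim l + 1) choose p} \<noteq> {}"
    using assms by (simp add: zero_less_binomial_iff lessThan_empty_iff)
  then show ?thesis
    unfolding weyman_summand_def using cohomology_nonempty by (subst vanishes_PiE) auto
qed

lemma vanishes_weyman_term:
  "vanishes (weyman_term l d m \<nu> :: (nat \<Rightarrow> nat \<Rightarrow> ('r::finite, 'k::ab_group_add) cochain set) set) \<longleftrightarrow>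
    (\<forall>p\<le>total_dim l + 1. vanishes (cohomology l (int p - \<nu>) (twist d m p) :: ('r, 'k) cochain set set))"
proof -
  have "(weyman_summand l d m \<nu> p :: (nat \<Rightarrow> ('r, 'k) cochain set) set) \<noteq> {}" for p
    unfolding weyman_summand_def PiE_eq_empty_iff using cohomology_nonempty by blast
  then have "vanishes (weyman_term l d m \<nu> :: (nat \<Rightarrow> nat \<Rightarrow> ('r, 'k) cochain set) set) \<longleftrightarrow>
      (\<forall>p\<in>{..total_dim l + 1}. vanishes (weyman_summand l d m \<nu> p :: (nat \<Rightarrow> ('r, 'k) cochain set) set))"
    unfolding weyman_term_def by (intro vanishes_PiE)
  then show ?thesis using vanishes_weyman_summand by (metis atMost_iff)
qed

text \<open>Some factor lies in the gap where its projective space has no cohomology, which by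
  Kuenneth kills the cohomology in all degrees.\<close>

definition acyclic_twist :: "('r \<Rightarrow> nat) \<Rightarrow> ('r \<Rightarrow> int) \<Rightarrow> bool" where
  "acyclic_twist l a \<longleftrightarrow> (\<exists>k. a k < 0 \<and> - int (l k) \<le> a k)"

lemma vanishes_cohomology_iff:
  fixes l :: "'r::finite \<Rightarrow> nat"
  shows "vanishes (cohomology l q a :: ('r, 'k::{ab_group_add, zero_neq_one}) cochain set set) \<longleftrightarrow>
    acyclic_twist l a \<or> q \<noteq> bott_degree l a"
  unfolding Bott_Kuenneth_vanishing acyclic_twist_def by (auto simp: not_le not_less)

lemma acyclic_middle_twists:
  assumes det: "determinantal TYPE('k::{ab_group_add, zero_neq_one}) l d m"
    and pure: "pure_Bezout TYPE('k) l d m"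
    and p: "1 \<le> p" "p \<le> total_dim l"
  shows "acyclic_twist l (twist d m p)"
proof -
  \<comment> \<open>The only term of the complex to which this \<open>p\<close> could contribute.
    Purity excludes it for \<nu> in {0, 1}, determinantality for all other \<nu>.\<close>
  define \<nu> where "\<nu> = int p - bott_degree l (twist d m p)"
  have "vanishes (cohomology l (int p - \<nu>) (twist d m p) :: ('a, 'k) cochain set set)"
  proof (cases "\<nu> \<in> {0, 1}")
    case True
    then have "vanishes (weyman_summand l d m \<nu> p :: (nat \<Rightarrow> ('a, 'k) cochain set) set)"
      using pure p unfolding pure_Bezout_def Let_def by auto
    then show ?thesis using p by (simp add: vanishes_weyman_summand)
  next
    case False
    then have "vanishes (weyman_term l d m \<nu> :: (nat \<Rightarrow> nat \<Rightarrow> ('a, 'k) cochain set) set)"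
      using det unfolding determinantal_def by blast
    then show ?thesis using p by (simp add: vanishes_weyman_term)
  qed
  then show ?thesis by (simp add: vanishes_cohomology_iff \<nu>_def)
qed

lemma bott_degree_nonneg: "(\<And>k. 0 \<le> a k) \<Longrightarrow> bott_degree l a = 0"
  unfolding bott_degree_def by (simp add: not_less[symmetric])

lemma bott_degree_neg: "(\<And>k. a k < 0) \<Longrightarrow> bott_degree l a = int (total_dim l)"
  unfolding bott_degree_def total_dim_def by simp

text \<open>Only the two outer twists have cohomology: \<open>p = 0\<close> in degree 0, hence only
  in term 0, and \<open>p = n + 1\<close> in degree \<open>n\<close>, hence only in term 1, where
  \<open>n\<close> is \<open>total_dim l\<close>.\<close>

lemma pure_Bezout_if_acyclic:
  fixes l :: "'r::finite \<Rightarrow> nat"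
  assumes first: "\<And>k. 0 \<le> m k" and last: "\<And>k. twist d m (total_dim l + 1) k < - int (l k)"
    and mid: "\<And>p. 1 \<le> p \<Longrightarrow> p \<le> total_dim l \<Longrightarrow> acyclic_twist l (twist d m p)"
  shows "determinantal TYPE('k::{ab_group_add, zero_neq_one}) l d m" "pure_Bezout TYPE('k) l d m"
proof -
  let ?n = "total_dim l"
  let ?van = "\<lambda>q p. vanishes (cohomology l q (twist d m p) :: ('r, 'k) cochain set set)"
  have t0: "twist d m 0 = m" by (simp add: twist_def)
  have van0: "?van q 0 \<longleftrightarrow> q \<noteq> 0" for q
    using first bott_degree_nonneg[of m l]
    by (auto simp: t0 vanishes_cohomology_iff acyclic_twist_def not_less[symmetric])
  have "twist d m (?n + 1) k < 0" for k
    using last[of k] by linarith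
  then have "bott_degree l (twist d m (?n + 1)) = int ?n"
    by (rule bott_degree_neg)
  moreover have "\<not> acyclic_twist l (twist d m (?n + 1))"
    using last unfolding acyclic_twist_def by (meson not_less)
  ultimately have vann: "?van q (?n + 1) \<longleftrightarrow> q \<noteq> int ?n" for q
    by (simp add: vanishes_cohomology_iff)
  have van: "?van q p" if "1 \<le> p" "p \<le> ?n" for q p
    using mid[OF that] by (simp add: vanishes_cohomology_iff)
  have all: "?van (int p - \<nu>) p" if "p \<le> ?n + 1" "p = 0 \<Longrightarrow> \<nu> \<noteq> 0" "p = ?n + 1 \<Longrightarrow> \<nu> \<noteq> 1" for p \<nu>
  proof -
    have "p = 0 \<or> p = ?n + 1 \<or> 1 \<le> p \<and> p \<le> ?n" using that(1) by linarith
    then consider "p = 0" | "p = ?n + 1" | "1 \<le> p" "p \<le> ?n" by blast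
    then show ?thesis
    proof cases
      case 1
      then show ?thesis using that(2) by (simp add: van0)
    next
      case 2
      have "int (?n + 1) - \<nu> \<noteq> int ?n" using that(3) 2 by simp
      then show ?thesis unfolding 2 vann .
    qed (rule van)
  qed
  show "determinantal TYPE('k) l d m"
    unfolding determinantal_def vanishes_weyman_term using all by simp
  show "pure_Bezout TYPE('k) l d m"
    unfolding pure_Bezout_def Let_def vanishes_weyman_term
  proof (intro conjI allI impI)
    show "?van (int p - - 1) p" if "p \<le> ?n + 1" for p
      by (rule all) (use that in auto)
    show "vanishes (weyman_summand l d m 1 p :: (nat \<Rightarrow> ('r, 'k) cochain set) set)"
      if "p \<le> ?n + 1" "p \<noteq> ?n + 1" for p
      unfolding vanishes_weyman_summand[OF that(1)] by (rule all) (use that in auto)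
    show "vanishes (weyman_summand l d m 0 p :: (nat \<Rightarrow> ('r, 'k) cochain set) set)"
      if "p \<le> ?n + 1" "p \<noteq> 0" for p
      unfolding vanishes_weyman_summand[OF that(1)] by (rule all) (use that in auto)
    show "\<not> ?van (int ?n) (?n + 1)" unfolding vann by simp
    show "\<not> vanishes (cohomology l 0 m :: ('r, 'k) cochain set set)"
      using van0[of 0] by (simp add: t0)
  qed
qed

section \<open>Counting and tiling the acyclic twists\<close>

lemma card_progression_le:
  fixes m :: int and l d :: nat
  assumes "1 \<le> d"
  shows "finite {p :: nat. m - int p * int d < 0 \<and> - int l \<le> m - int p * int d}" (is "finite ?A")
    and "card {p :: nat. m - int p * int d < 0 \<and> - int l \<le> m - int p * int d} \<le> l"
    and "2 \<le> l \<Longrightarrow> 2 \<le> d \<Longrightarrow>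
      card {p :: nat. m - int p * int d < 0 \<and> - int l \<le> m - int p * int d} < l"
proof -
  let ?f = "\<lambda>p :: nat. m - int p * int d"
  \<comment> \<open>As \<open>d\<close> is positive, distinct \<open>p\<close> give distinct values,
    all in an interval of \<open>l\<close> integers.\<close>
  have inj: "inj_on ?f ?A" using assms by (auto simp: inj_on_def)
  have sub: "?f ` ?A \<subseteq> {- int l..<0}" by auto
  show "finite ?A" using inj sub finite_subset finite_imageD by blast
  show "card ?A \<le> l" using card_inj_on_le[OF inj sub] by simp
  show "card ?A < l" if ld: "2 \<le> l" "2 \<le> d"
  proof -
    \<comment> \<open>Filling the interval would reach both -1 and -2, but values of the progression
      differ by multiples of \<open>d\<close>, which is at least 2.\<close>
    have "?f ` ?A \<noteq> {- int l..<0}"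
    proof
      assume "?f ` ?A = {- int l..<0}"
      moreover have "- 1 \<in> {- int l..<0}" "- 2 \<in> {- int l..<0}" using ld(1) by auto
      ultimately obtain p p' where "?f p = - 1" "?f p' = - 2" by (metis (no_types, lifting) imageE)
      then have "(int p' - int p) * int d = 1" by (simp add: algebra_simps)
      then have "int d dvd 1" by (metis dvd_triv_right)
      then show False using ld(2) by simp
    qed
    then have "?f ` ?A \<subset> {- int l..<0}" using sub by blast
    then have "card (?f ` ?A) < card {- int l..<0}" by (intro psubset_card_mono) auto
    then show ?thesis using inj by (simp add: card_image)
  qed
qed

text \<open>Blocks of lengths \<open>l k\<close> are laid end to end; \<open>s k\<close> is the
  position just before the block of \<open>k\<close>, and a new block starts at the previous
  total.\<close>

lemma exists_tiling:
  fixes l :: "'r \<Rightarrow> nat"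
  assumes "finite S"
  shows "\<exists>s :: 'r \<Rightarrow> nat. (\<forall>k\<in>S. s k + l k \<le> (\<Sum>k\<in>S. l k)) \<and>
    (\<forall>p. 1 \<le> p \<and> p \<le> (\<Sum>k\<in>S. l k) \<longrightarrow> (\<exists>k\<in>S. s k < p \<and> p \<le> s k + l k))"
  using assms
proof (induction S)
  case (insert x S)
  let ?n = "\<Sum>k\<in>S. l k"
  obtain s where s: "\<forall>k\<in>S. s k + l k \<le> ?n"
    "\<And>p. 1 \<le> p \<and> p \<le> ?n \<Longrightarrow> \<exists>k\<in>S. s k < p \<and> p \<le> s k + l k"
    using insert.IH by blast
  let ?s = "s(x := ?n)"
  have "\<exists>k\<in>insert x S. ?s k < p \<and> p \<le> ?s k + l k" if p: "1 \<le> p" "p \<le> l x + ?n" for p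
  proof (cases "p \<le> ?n")
    case True
    then obtain k where "k \<in> S" "s k < p \<and> p \<le> s k + l k" using s(2) p(1) by blast
    then show ?thesis using insert.hyps by (intro bexI[of _ k]) auto
  next
    case False
    then show ?thesis using p(2) by (intro bexI[of _ x]) auto
  qed
  moreover have "\<forall>k\<in>insert x S. ?s k + l k \<le> l x + ?n"
    using s(1) by (simp add: trans_le_add2)
  ultimately show ?case using insert.hyps by (intro exI[of _ ?s]) simp
qed simp

text \<open>A zero defect means \<open>l k - 1 < l k / d k\<close>, that is
  \<open>(l k - 1) * d k < l k\<close>. This fails when both numbers are at least 2, since then
  already \<open>(l k - 1) * 2\<close> is at least \<open>l k\<close>.\<close>

lemma defect_eq_0_iff:
  assumes "1 \<le> l k" "1 \<le> d k"
  shows "defect l d k = 0 \<longleftrightarrow> l k = 1 \<or> d k = 1"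
proof
  assume "defect l d k = 0"
  then have "\<lceil>real (l k) / real (d k)\<rceil> = int (l k)" by (simp add: defect_def)
  then have "real (l k) - 1 < real (l k) / real (d k)" by (simp add: ceiling_eq_iff)
  then have "(real (l k) - 1) * real (d k) < real (l k)" using assms(2) by (simp add: field_simps)
  then have *: "(int (l k) - 1) * int (d k) < int (l k)" by (metis (mono_tags) of_int_less_iff of_int_mult of_int_diff of_int_1 of_int_of_nat_eq)
  show "l k = 1 \<or> d k = 1"
  proof (rule ccontr)
    assume "\<not> ?thesis"
    then have "2 \<le> l k" "2 \<le> d k" using assms by auto
    then have "(int (l k) - 1) * 2 \<le> (int (l k) - 1) * int (d k)" by (intro mult_left_mono) auto
    from this * have "(int (l k) - 1) * 2 < int (l k)" by (rule le_less_trans)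
    then show False using \<open>2 \<le> l k\<close> by simp
  qed
next
  assume "l k = 1 \<or> d k = 1"
  then show "defect l d k = 0"
  proof
    assume "l k = 1"
    moreover have "\<lceil>1 / real (d k)\<rceil> = 1"
      using assms(2) by (simp add: ceiling_eq_iff)
    ultimately show ?thesis by (simp add: defect_def)
  qed (simp add: defect_def)
qed

theorem theorem6p2:
  fixes l d :: "'r::finite \<Rightarrow> nat"
  assumes "\<And>k. 1 \<le> l k" and "\<And>k. 1 \<le> d k"
  shows "((\<exists>m :: 'r \<Rightarrow> int.
            determinantal TYPE('k::{alg_closed_field, field_char_0}) l d m \<and>
            pure_Bezout TYPE('k) l d m)
          \<longleftrightarrow> (\<forall>k. l k = 1 \<or> d k = 1)) \<and>
         ((\<forall>k. l k = 1 \<or> d k = 1) \<longleftrightarrow> (\<forall>k. defect l d k = 0))"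
proof (intro conjI iffI)
  let ?n = "total_dim l"
  assume "\<exists>m :: 'r \<Rightarrow> int. determinantal TYPE('k) l d m \<and> pure_Bezout TYPE('k) l d m"
  then obtain m :: "'r \<Rightarrow> int"
    where m: "determinantal TYPE('k) l d m" "pure_Bezout TYPE('k) l d m" by blast
  define A where "A k = {p :: nat. m k - int p * int (d k) < 0 \<and>
    - int (l k) \<le> m k - int p * int (d k)}" for k
  have A: "finite (A k)" "card (A k) \<le> l k" for k
    unfolding A_def using card_progression_le(1,2)[OF assms(2)] by auto
  \<comment> \<open>Every middle twist is acyclic through some factor, so the sets
    \<open>A k\<close> must cover \<open>n\<close> numbers while their sizes are bounded by the
    \<open>l k\<close>, whose sum is \<open>n\<close>.\<close>
  have "{1..?n} \<subseteq> (\<Union>k. A k)"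
    using acyclic_middle_twists[OF m] by (force simp: acyclic_twist_def twist_def A_def)
  then have "card {1..?n} \<le> card (\<Union>k. A k)"
    using A(1) by (intro card_mono) auto
  also have "\<dots> \<le> (\<Sum>k\<in>UNIV. card (A k))"
    by (rule card_UN_le) simp
  finally have n: "(\<Sum>k\<in>UNIV. l k) \<le> (\<Sum>k\<in>UNIV. card (A k))"
    by (simp add: total_dim_def)
  show "\<forall>k. l k = 1 \<or> d k = 1"
  proof (rule ccontr)
    assume "\<not> ?thesis"
    then obtain k where "l k \<noteq> 1" "d k \<noteq> 1" by blast
    then have "2 \<le> l k" "2 \<le> d k" using assms[of k] by auto
    then have "card (A k) < l k"
      unfolding A_def by (rule card_progression_le(3)[OF assms(2)])
    then have "(\<Sum>k\<in>UNIV. card (A k)) < (\<Sum>k\<in>UNIV. l k)"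
      using A(2) by (intro sum_strict_mono_ex1) auto
    then show False using n by simp
  qed
next
  let ?n = "total_dim l"
  assume ld: "\<forall>k. l k = 1 \<or> d k = 1"
  obtain s where s: "\<And>k. s k + l k \<le> ?n"
    "\<And>p. 1 \<le> p \<Longrightarrow> p \<le> ?n \<Longrightarrow> \<exists>k. s k < p \<and> p \<le> s k + l k"
    using exists_tiling[of UNIV l] unfolding total_dim_def by auto
  \<comment> \<open>Chosen so that the twist at \<open>p = s k + 1\<close>, the first position of
    the block of \<open>k\<close>, is exactly -1, the top of the acyclic range.\<close>
  define m where "m k = (int (s k) + 1) * int (d k) - 1" for k
  have tw: "twist d m p k = (int (s k) + 1 - int p) * int (d k) - 1" for p k
    by (simp add: twist_def m_def algebra_simps)
  have "0 \<le> m k" for k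
  proof -
    have "1 * 1 \<le> (int (s k) + 1) * int (d k)"
      using assms(2)[of k] by (intro mult_mono) auto
    then show ?thesis by (simp add: m_def)
  qed
  moreover have "twist d m (?n + 1) k < - int (l k)" for k
  proof -
    \<comment> \<open>At \<open>p = n + 1\<close> the twist is \<open>(s k - n) * d k - 1\<close>;
      since the block of \<open>k\<close> ends by \<open>n\<close>, this is at most
      \<open>- l k - 1\<close>.\<close>
    have "int (l k) * 1 \<le> (int ?n - int (s k)) * int (d k)"
      using s(1)[of k] assms(2)[of k] by (intro mult_mono) auto
    then show ?thesis by (simp add: tw algebra_simps)
  qed
  moreover have "acyclic_twist l (twist d m p)" if p: "1 \<le> p" "p \<le> ?n" for p
  proof -
    obtain k where k: "s k < p" "p \<le> s k + l k" using s(2) p by blast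
    have "(int (s k) + 1 - int p) * int (d k) \<le> 0"
      using k(1) by (intro mult_nonpos_nonneg) auto
    \<comment> \<open>If \<open>d k = 1\<close>, the twists descend by one through the block and end
      at \<open>- l k\<close>. Otherwise \<open>l k = 1\<close>, the block is a single position and
      the product is 0.\<close>
    moreover have "1 - int (l k) \<le> (int (s k) + 1 - int p) * int (d k)"
    proof (cases "d k = 1")
      case False
      then have "l k = 1" using ld by blast
      then have "int p = int (s k) + 1" using k by linarith
      then show ?thesis using assms(1)[of k] by simp
    qed (use k in simp)
    ultimately show ?thesis
      unfolding acyclic_twist_def tw by (intro exI[of _ k]) simp
  qed
  ultimately show "\<exists>m :: 'r \<Rightarrow> int. determinantal TYPE('k) l d m \<and> pure_Bezout TYPE('k) l d m"
    using pure_Bezout_if_acyclic by blast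
qed (simp_all add: defect_eq_0_iff[of l _ d, OF assms])

end
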